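(* There is a constant $c>0$ such that $\tau(d)\ge (cd)^{d/2}$ for all $d$ that are powers of $2$.
   Context: For an integer $d\ge1$, a sequence $v_1,\dots,v_t$ ($t\ge 2$) of vectors in $[-1,1]^d$ is called minimal if (i) $v_1+\dots+v_t\in[-1,1]^d$, and (ii) for every index set $S\subset\{1,\dots,t\}$ with $2\le |S|<t$, the sum $\sum_{i\in S}v_i$ lies outside $[-1,1]^d$. Let $\tau(d)$ denote the largest $t$ for which a minimal sequence of length $t$ in $[-1,1]^d$ exists. *)

theory Defs
  imports Complex_Main
begin

text \<open>Vectors in R^d are represented as functions nat => real, only coordinates i < d matter.
  A sequence v_1..v_t is represented as v :: nat => nat => real, indexed by k < t.\<close>

definition in_cube :: "nat \<Rightarrow> (nat \<Rightarrow> real) \<Rightarrow> bool" where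
  "in_cube d x \<longleftrightarrow> (\<forall>i<d. \<bar>x i\<bar> \<le> 1)"

definition minimal_seq :: "nat \<Rightarrow> nat \<Rightarrow> (nat \<Rightarrow> nat \<Rightarrow> real) \<Rightarrow> bool" where
  "minimal_seq d t v \<longleftrightarrow>
     2 \<le> t \<and>
     (\<forall>k<t. in_cube d (v k)) \<and>
     in_cube d (\<lambda>i. \<Sum>k<t. v k i) \<and>
     (\<forall>S. S \<subseteq> {..<t} \<and> 2 \<le> card S \<and> card S < t \<longrightarrow>
          \<not> in_cube d (\<lambda>i. \<Sum>k\<in>S. v k i))"

end

theory Submission
  imports Defs
begin

text \<open>Let M be a d x d matrix with entries 1 and -1 and e a vector of signs. Take a shortest sequence of
  signed columns of M that sums to e, and flip rows so that the sum becomes -1 in every coordinate. Now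
  replace every entry -1 by -1 + \<eta> with a tiny \<eta> > 0. A subsum of at least two of the
  vectors that lies in the cube must come from an integral sum with all coordinates in {-1, 0}, because a
  coordinate sum of 1 uses some negative entry and is pushed above 1. By parity the integral sum is then
  constantly 0 or constantly -1, and in both cases (pass to the complement in the first) minimality of
  the length forces the subsum to be empty or full.

  So it suffices that M w = e has an integral solution and that every integral solution has
  \<open>l\<^sub>1\<close>-norm at least \<open>(c d)\<^bsup>d/2\<^esup>\<close>. The ill-conditioned matrices of Hastad and of Alon and Vu do this. Order the
  subsets \<open>A\<^sub>0, A\<^sub>1, \<dots>\<close> of an m-set, \<open>d = 2\<^sup>m\<close>, by size so that consecutive sets differ by adding or exchanging one
  element. In terms of the Walsh coefficients y of w, row i + 1 of M w = e reads
  \<open>y(A\<^sub>i\<^sub>+\<^sub>1) = (2\<^bsup>k-1\<^esup> - 1) y(A\<^sub>i) + 2\<^bsup>k-1\<^esup> e\<^sub>i\<^sub>+\<^sub>1 - (coefficients of smaller sets)\<close> with \<open>k = |A\<^sub>i\<^sub>+\<^sub>1|\<close>, so the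
  coefficients grow by a factor of about \<open>2\<^bsup>k-1\<^esup>\<close> in each step, and the product of these factors is
  \<open>d\<^bsup>d/2\<^esup>\<close> up to an exponential factor.\<close>

section \<open>Minimal sequences from sign vectors\<close>

text \<open>\<open>shortest\<close> compares only subsequences of \<open>u\<close> itself, since the
  argument applies it just to a bad index set \<open>S\<close> and to its complement.\<close>

lemma minimal_seq_of_sign_vectors:
  fixes u :: "nat \<Rightarrow> nat \<Rightarrow> int"
  assumes t: "2 \<le> t" and d: "0 < d"
    and sgn: "\<And>k i. k < t \<Longrightarrow> i < d \<Longrightarrow> u k i = 1 \<or> u k i = - 1"
    and total: "\<And>i. i < d \<Longrightarrow> (\<Sum>k<t. u k i) = - 1"
    and shortest: "\<And>S. S \<subseteq> {..<t} \<Longrightarrow> (\<And>i. i < d \<Longrightarrow> (\<Sum>k\<in>S. u k i) = - 1) \<Longrightarrow> S = {..<t}"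
  shows "minimal_seq d t (\<lambda>k i. if u k i = 1 then 1 else - 1 + 1 / (real t + 1))"
    (is "minimal_seq d t ?v")
proof -
  define q where "q S i = card {k \<in> S. u k i \<noteq> 1}" for S i
  have row: "(\<Sum>k\<in>S. ?v k i) = of_int (\<Sum>k\<in>S. u k i) + real (q S i) / (real t + 1)"
    if S: "S \<subseteq> {..<t}" and i: "i < d" for S i
  proof -
    have fin: "finite S" using S finite_subset by blast
    have "(\<Sum>k\<in>S. ?v k i) = (\<Sum>k\<in>S. of_int (u k i) + (if u k i \<noteq> 1 then 1 / (real t + 1) else 0))"
      using S i sgn by (intro sum.cong refl) force
    also have "\<dots> = of_int (\<Sum>k\<in>S. u k i) + (\<Sum>k\<in>S. if u k i \<noteq> 1 then 1 / (real t + 1) else 0)"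
      by (simp add: sum.distrib)
    also have "(\<Sum>k\<in>S. if u k i \<noteq> 1 then 1 / (real t + 1) else 0) = real (q S i) / (real t + 1)"
      using fin by (simp add: q_def sum.If_cases Int_def conj_commute)
    finally show ?thesis .
  qed
  \<comment> \<open>At most \<open>t\<close> perturbations of size \<open>1 / (t + 1)\<close> add up
    to less than 1. The strictness later excludes an integral sum of -2.\<close>
  have q_le: "0 \<le> real (q S i) / (real t + 1)" "real (q S i) / (real t + 1) < 1" if "S \<subseteq> {..<t}" for S i
  proof -
    have "q S i \<le> card {..<t}"
      unfolding q_def using that by (intro card_mono) auto
    then show "0 \<le> real (q S i) / (real t + 1)" "real (q S i) / (real t + 1) < 1"
      by (auto simp: field_simps)
  qed
  have single: "in_cube d (?v k)" for k
    unfolding in_cube_def by (auto simp: abs_le_iff field_simps)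
  have whole: "in_cube d (\<lambda>i. \<Sum>k<t. ?v k i)"
    unfolding in_cube_def
  proof (intro allI impI)
    fix i assume i: "i < d"
    show "\<bar>\<Sum>k<t. ?v k i\<bar> \<le> 1"
      using row[OF order_refl i] total[OF i] q_le[OF order_refl, of i] by simp
  qed
  have proper: "\<not> in_cube d (\<lambda>i. \<Sum>k\<in>S. ?v k i)" 
    if S: "S \<subseteq> {..<t}" and c2: "2 \<le> card S" and ct: "card S < t" for S
  proof
    assume cube: "in_cube d (\<lambda>i. \<Sum>k\<in>S. ?v k i)"
    define s where "s i = (\<Sum>k\<in>S. u k i)" for i
    have fin: "finite S" using S finite_subset by blast
    have s_cases: "s i = 0 \<or> s i = - 1" if i: "i < d" for i
    proof -
      have r: "\<bar>real_of_int (s i) + real (q S i) / (real t + 1)\<bar> \<le> 1"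
        using cube i row[OF S i] unfolding in_cube_def s_def by auto
      have "real_of_int (s i) \<le> 1" "real_of_int (s i) > - 2"
        using r q_le[OF S, of i] by linarith+
      then have "s i = - 1 \<or> s i = 0 \<or> s i = 1" by linarith
      moreover have "s i \<noteq> 1"
      proof
        assume one: "s i = 1"
        then have "q S i = 0" using r q_le[OF S, of i] by (auto simp: divide_le_0_iff)
        then have "\<forall>k\<in>S. u k i = 1" using fin by (auto simp: q_def)
        then have "s i = int (card S)" by (simp add: s_def)
        then show False using one c2 by simp
      qed
      ultimately show ?thesis by auto
    qed
    have parity: "even (s i) = even (card S)" if i: "i < d" for i
    proof -
      have "s i + int (card S) = (\<Sum>k\<in>S. u k i + 1)"
        by (simp add: s_def sum.distrib)
      moreover have "even (\<Sum>k\<in>S. u k i + 1)"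
        using S i sgn by (intro dvd_sum) force
      ultimately have "even (s i + int (card S))" by simp
      then show ?thesis by simp
    qed
    show False
    proof (cases "even (card S)")
      case True
      then have "s i = 0" if "i < d" for i
        using s_cases[OF that] parity[OF that] by auto
      then have "(\<Sum>k\<in>{..<t} - S. u k i) = - 1" if "i < d" for i
        using that total[OF that] S by (simp add: sum_diff s_def)
      then have "{..<t} - S = {..<t}" by (intro shortest) auto
      then have "S = {}" using S by blast
      then show False using c2 by simp
    next
      case False
      then have "s i = - 1" if "i < d" for i
        using s_cases[OF that] parity[OF that] by auto
      then have "S = {..<t}" using S by (intro shortest) (auto simp: s_def)
      then show False using ct by simp
    qed
  qed
  show ?thesis
    unfolding minimal_seq_def using t single whole proper by blast
qed

section \<open>An ordering of the subsets of a finite set\<close>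

text \<open>The revolving-door Gray code of the k-subsets: neighbours arise by exchanging one element.\<close>

fun revolving_door :: "nat \<Rightarrow> nat \<Rightarrow> nat set list" where
  "revolving_door n 0 = [{}]"
| "revolving_door 0 (Suc k) = []"
| "revolving_door (Suc n) (Suc k) =
     revolving_door n (Suc k) @ map (insert n) (rev (revolving_door n k))"

lemma set_revolving_door: "set (revolving_door n k) = {S. S \<subseteq> {..<n} \<and> card S = k}"
proof (induction n k rule: revolving_door.induct)
  case (1 n)
  then show ?case by (auto dest: finite_subset)
next
  case (2 k)
  then show ?case by auto
next
  case (3 n k)
  show ?case
  proof (intro equalityI subsetI)
    fix S assume "S \<in> set (revolving_door (Suc n) (Suc k))"
    then consider "S \<subseteq> {..<n}" "card S = Suc k"
      | T where "S = insert n T" "T \<subseteq> {..<n}" "card T = k"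
      using 3 by auto
    then show "S \<in> {S. S \<subseteq> {..<Suc n} \<and> card S = Suc k}"
    proof cases
      case (2 T)
      then have "finite T" "n \<notin> T" using finite_subset by auto
      then show ?thesis using 2 by auto
    qed auto
  next
    fix S assume S: "S \<in> {S. S \<subseteq> {..<Suc n} \<and> card S = Suc k}"
    then have fin: "finite S" using finite_subset by blast
    show "S \<in> set (revolving_door (Suc n) (Suc k))"
    proof (cases "n \<in> S")
      case True
      then have "S = insert n (S - {n})" by blast
      moreover have "S - {n} \<in> set (revolving_door n k)"
        using S fin True 3(2) by (auto simp: less_Suc_eq)
      ultimately have "S \<in> insert n ` set (revolving_door n k)" by (rule image_eqI)
      then show ?thesis by simp
    next
      case False
      then have "S \<subseteq> {..<n}" using S by (auto simp: less_Suc_eq)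
      then show ?thesis using 3 S by auto
    qed
  qed
qed

lemma distinct_revolving_door: "distinct (revolving_door n k)"
proof (induction n k rule: revolving_door.induct)
  case (3 n k)
  have "inj_on (insert n) (set (revolving_door n k))"
    by (rule inj_onI) (auto simp: set_revolving_door insert_eq_iff)
  then show ?case using 3 by (auto simp: distinct_map set_revolving_door)
qed auto

lemma revolving_door_nonempty: "k \<le> n \<Longrightarrow> revolving_door n k \<noteq> []"
proof -
  assume "k \<le> n"
  then have "{..<k} \<in> set (revolving_door n k)" by (simp add: set_revolving_door)
  then show ?thesis by auto
qed

lemma revolving_door_eq_Nil: "n < k \<Longrightarrow> revolving_door n k = []"
proof -
  assume "n < k"
  have "card S \<noteq> k" if "S \<subseteq> {..<n}" for S
    using card_mono[OF _ that] \<open>n < k\<close> by auto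
  then have "set (revolving_door n k) = {}" by (auto simp: set_revolving_door)
  then show ?thesis by simp
qed

text \<open>Both ends are made explicit because the halves of the recursion, and later the levels,
  are glued there.\<close>

lemma hd_last_revolving_door:
  "k \<le> n \<Longrightarrow> hd (revolving_door n k) = {..<k} \<and>
     last (revolving_door n k) = (if k = 0 then {} else insert (n - 1) {..<k - 1})"
proof (induction n k rule: revolving_door.induct)
  case (3 n k)
  have ne: "revolving_door n k \<noteq> []" using 3 by (intro revolving_door_nonempty) auto
  have l: "last (revolving_door (Suc n) (Suc k)) = insert n {..<k}"
    using 3 ne by (simp add: last_map last_rev)
  have h: "hd (revolving_door (Suc n) (Suc k)) = {..<Suc k}"
  proof (cases "Suc k \<le> n")
    case True
    then show ?thesis using 3(1) revolving_door_nonempty[OF True] by simp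
  next
    case False
    \<comment> \<open>The first half is empty here, so the list begins with the reversed second
      half.\<close>
    then have [simp]: "k = n" using 3 by auto
    have "hd (revolving_door (Suc n) (Suc k)) = insert n (last (revolving_door n n))"
      using ne by (simp add: revolving_door_eq_Nil hd_map hd_rev)
    also have "\<dots> = {..<Suc n}"
      using 3(2) by (cases n) auto
    finally show ?thesis by simp
  qed
  show ?case using l h by simp
qed auto

lemma successively_revolving_door:
  "successively (\<lambda>S T. card (S \<inter> T) + 1 = k) (revolving_door n k)"
proof (induction n k rule: revolving_door.induct)
  case (3 n k)
  have "successively (\<lambda>S T. card (insert n S \<inter> insert n T) + 1 = Suc k) (revolving_door n k)"
  proof (rule successively_mono[OF 3(2)])
    fix S T assume "S \<in> set (revolving_door n k)" "T \<in> set (revolving_door n k)"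
      and "card (S \<inter> T) + 1 = k"
    moreover from this have "finite (S \<inter> T)" "n \<notin> S"
      by (auto simp: set_revolving_door dest: finite_subset)
    ultimately show "card (insert n S \<inter> insert n T) + 1 = Suc k"
      by simp
  qed
  then have two: "successively (\<lambda>S T. card (S \<inter> T) + 1 = Suc k)
      (map (insert n) (rev (revolving_door n k)))"
    by (simp add: successively_map Int_commute)
  \<comment> \<open>For \<open>k > 0\<close> the sets meeting here are
    \<open>insert (n - 1) {..<k}\<close> and \<open>insert n (insert (n - 1) {..<k - 1})\<close>:
    the exchange is \<open>k - 1\<close> for \<open>n\<close>.\<close>
  have junction: "card (last (revolving_door n (Suc k)) \<inter>
      hd (map (insert n) (rev (revolving_door n k)))) + 1 = Suc k"
    if ne: "revolving_door n (Suc k) \<noteq> []"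
  proof -
    have kn: "Suc k \<le> n" using ne revolving_door_eq_Nil[of n "Suc k"] by force
    have "hd (map (insert n) (rev (revolving_door n k))) = insert n (last (revolving_door n k))"
      using revolving_door_nonempty[of k n] kn by (simp add: hd_map hd_rev)
    moreover have "last (revolving_door n (Suc k)) \<inter> insert n (last (revolving_door n k)) =
        (if k = 0 then {} else insert (n - 1) {..<k - 1})"
      using hd_last_revolving_door[of k n] hd_last_revolving_door[of "Suc k" n] kn by auto
    moreover have "card (if k = 0 then {} else insert (n - 1) {..<k - 1}) = k"
      using kn by auto
    ultimately show ?thesis by simp
  qed
  show ?case using 3(1) two junction by (auto simp: successively_append_iff)
qed auto

text \<open>Traversing the levels alternately forwards and backwards makes the end of each level a subset
  of the start of the next one.\<close>

lemma levels_enumeration: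
  "K \<le> Suc m \<Longrightarrow> \<exists>xs. set xs = {S. S \<subseteq> {..<m} \<and> card S < K} \<and> distinct xs \<and>
     sorted (map card xs) \<and> successively (\<lambda>S T. card (S \<inter> T) + 1 = card T) xs \<and>
     (K > 0 \<longrightarrow> xs \<noteq> [] \<and> last xs =
        (if even K then {..<K - 1} else if K = 1 then {} else insert (m - 1) {..<K - 2}))"
proof (induction K)
  case 0
  then show ?case by (intro exI[of _ "[]"]) auto
next
  case (Suc K)
  then obtain xs where xs: "set xs = {S. S \<subseteq> {..<m} \<and> card S < K}" "distinct xs"
     "sorted (map card xs)" "successively (\<lambda>S T. card (S \<inter> T) + 1 = card T) xs"
     "K > 0 \<Longrightarrow> xs \<noteq> []" "K > 0 \<Longrightarrow> last xs =
        (if even K then {..<K - 1} else if K = 1 then {} else insert (m - 1) {..<K - 2})"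
    by auto
  have Km: "K \<le> m" using Suc by simp
  define ys where "ys = (if even K then revolving_door m K else rev (revolving_door m K))"
  have ys: "set ys = {S. S \<subseteq> {..<m} \<and> card S = K}" "distinct ys" "ys \<noteq> []"
    using distinct_revolving_door revolving_door_nonempty[OF Km] by (auto simp: ys_def set_revolving_door)
  have succ: "successively (\<lambda>S T. card (S \<inter> T) + 1 = card T) ys"
  proof -
    have "successively (\<lambda>S T. card (S \<inter> T) + 1 = K) ys"
      using successively_revolving_door[of K m] by (auto simp: ys_def Int_commute)
    then show ?thesis by (rule successively_mono) (use ys in auto)
  qed
  have hd_ys: "hd ys = (if even K then {..<K} else insert (m - 1) {..<K - 1})"
    using hd_last_revolving_door[OF Km] revolving_door_nonempty[OF Km]
    by (auto simp: ys_def hd_rev)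
  have last_ys: "last ys = (if odd K then {..<K} else if K = 0 then {} else insert (m - 1) {..<K - 1})"
    using hd_last_revolving_door[OF Km] revolving_door_nonempty[OF Km]
    by (auto simp: ys_def last_rev)
  \<comment> \<open>For even \<open>K\<close>, \<open>{..<K - 1}\<close> lies in
    \<open>{..<K}\<close>; for odd \<open>K > 1\<close>, \<open>insert (m - 1) {..<K - 2}\<close>
    lies in \<open>insert (m - 1) {..<K - 1}\<close>.\<close>
  have junction: "card (last xs \<inter> hd ys) + 1 = card (hd ys)" if "xs \<noteq> []"
  proof -
    have K0: "K > 0" using that xs(1) by (cases K) auto
    have card_hd: "card (hd ys) = K" using ys by (metis (mono_tags, lifting) hd_in_set mem_Collect_eq)
    have "last xs \<inter> hd ys =
      (if even K then {..<K - 1} else if K = 1 then {} else insert (m - 1) {..<K - 2})"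
      using xs(6)[OF K0] hd_ys K0 Km by auto
    moreover have "card (insert (m - 1) {..<K - 2}) = K - 1" if "odd K" "K \<noteq> 1"
      using Km that K0 by (cases "K = 2") (auto simp: card_insert_if)
    ultimately show ?thesis using K0 card_hd by auto
  qed
  have "map card ys = replicate (length ys) K"
    using ys(1) by (intro replicate_eqI) auto
  then have "sorted (map card (xs @ ys))"
    using xs(1,3) by (auto simp: sorted_append)
  moreover have "set (xs @ ys) = {S. S \<subseteq> {..<m} \<and> card S < Suc K}" using xs(1) ys(1) by auto
  moreover have "distinct (xs @ ys)" using xs(1,2) ys by auto
  moreover have "successively (\<lambda>S T. card (S \<inter> T) + 1 = card T) (xs @ ys)"
    using succ xs(4) junction by (auto simp: successively_append_iff)
  moreover have "last (xs @ ys) =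
    (if even (Suc K) then {..<Suc K - 1} else if Suc K = 1 then {} else insert (m - 1) {..<Suc K - 2})"
    using last_ys ys(3) by auto
  ultimately show ?case using ys(3) by (intro exI[of _ "xs @ ys"]) auto
qed

text \<open>One equation serves both an exchange within a level and an added element between levels;
  it fixes the power of 2 in the later recursion as half of
  \<open>2 ^ card (A (Suc i))\<close>.\<close>

lemma subset_enumeration:
  obtains A :: "nat \<Rightarrow> nat set" where
    "bij_betw A {..<2 ^ m} (Pow {..<m})"
    "\<And>i j. i \<le> j \<Longrightarrow> j < 2 ^ m \<Longrightarrow> card (A i) \<le> card (A j)"
    "\<And>i. Suc i < 2 ^ m \<Longrightarrow> card (A (Suc i) \<inter> A i) + 1 = card (A (Suc i))"
proof -
  obtain xs where xs: "set xs = {S. S \<subseteq> {..<m} \<and> card S < Suc m}" "distinct xs"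
     "sorted (map card xs)" "successively (\<lambda>S T. card (S \<inter> T) + 1 = card T) xs"
    using levels_enumeration[of "Suc m" m] by auto
  have "card S < Suc m" if "S \<subseteq> {..<m}" for S
    using card_mono[OF _ that] by simp
  then have set: "set xs = Pow {..<m}" using xs(1) by auto
  then have len: "length xs = 2 ^ m"
    using distinct_card[OF xs(2)] by (simp add: card_Pow)
  have adj: "P (xs ! i) (xs ! Suc i)" if "successively P xs" "Suc i < length xs" for P and xs :: "nat set list" and i
    using that by (induction P xs arbitrary: i rule: successively.induct)
      (auto simp: nth_Cons split: nat.splits)
  show ?thesis
  proof
    show "bij_betw ((!) xs) {..<2 ^ m} (Pow {..<m})"
      using xs(2) set len by (metis bij_betw_nth)
    show "card (xs ! i) \<le> card (xs ! j)" if "i \<le> j" "j < 2 ^ m" for i j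
      using sorted_nth_mono[OF xs(3), of i j] that len by simp
    show "card (xs ! Suc i \<inter> xs ! i) + 1 = card (xs ! Suc i)" if "Suc i < 2 ^ m" for i
      using adj[OF xs(4)] that len by (simp add: Int_commute)
  qed
qed

section \<open>An ill-conditioned sign matrix\<close>

text \<open>On finite sets these are the characters of the group of subsets under symmetric
  difference, the entries of the Sylvester Hadamard matrix.\<close>

definition walsh :: "nat set \<Rightarrow> nat set \<Rightarrow> int" where
  "walsh S Z = (- 1) ^ card (S \<inter> Z)"

lemma walsh_commute: "walsh S Z = walsh Z S"
  by (simp add: walsh_def Int_commute)

lemma walsh_empty [simp]: "walsh {} Z = 1"
  by (simp add: walsh_def)

lemma walsh_cases: "walsh S Z = 1 \<or> walsh S Z = - 1"
  by (cases "even (card (S \<inter> Z))") (auto simp: walsh_def)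

lemma walsh_conv_prod:
  assumes "finite S"
  shows "walsh S Z = (\<Prod>a\<in>S. if a \<in> Z then - 1 else 1)"
  using assms by (simp add: walsh_def prod.If_cases)

lemma walsh_Diff:
  assumes "finite S" "T \<subseteq> S"
  shows "walsh (S - T) Z = walsh S Z * walsh T Z"
proof -
  have "walsh S Z = walsh (S - T) Z * walsh T Z"
    using assms prod.subset_diff[OF assms(2,1), of "\<lambda>a. if a \<in> Z then - 1 else (1::int)"]
    by (simp add: walsh_conv_prod finite_subset)
  then show ?thesis using walsh_cases[of T Z] by auto
qed

lemma sum_Pow_prod:
  fixes f :: "'a \<Rightarrow> 'b :: comm_semiring_1"
  assumes "finite A"
  shows "(\<Sum>X\<in>Pow A. \<Prod>x\<in>X. f x) = (\<Prod>x\<in>A. f x + 1)"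
  using prod_add[OF assms, of f "\<lambda>_. 1"] by simp

text \<open>The sum factors over the elements of \<open>D\<close>, with factor 2 off
  \<open>Z\<close> and 0 on \<open>Z\<close>. This turns the case distinction in \<open>row\<close>
  into a sum of Walsh functions.\<close>

lemma sum_walsh_Diff:
  assumes "finite S" "D \<subseteq> S"
  shows "(\<Sum>T\<in>Pow D. walsh (S - T) Z) = (if D \<inter> Z = {} then 2 ^ card D * walsh S Z else 0)"
proof -
  have fin: "finite D" using assms finite_subset by blast
  have "(\<Sum>T\<in>Pow D. walsh (S - T) Z) = walsh S Z * (\<Sum>T\<in>Pow D. \<Prod>a\<in>T. if a \<in> Z then - 1 else 1)"
    unfolding sum_distrib_left
  proof (intro sum.cong refl)
    fix T assume "T \<in> Pow D"
    then have "T \<subseteq> S" "finite T" using assms(2) fin finite_subset by auto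
    then show "walsh (S - T) Z = walsh S Z * (\<Prod>a\<in>T. if a \<in> Z then - 1 else 1)"
      using walsh_Diff[OF assms(1)] walsh_conv_prod[of T] by simp
  qed
  also have "\<dots> = walsh S Z * (\<Prod>a\<in>D. (if a \<in> Z then - 1 else 1) + 1)"
    using sum_Pow_prod[OF fin, of "\<lambda>a. if a \<in> Z then - 1 else (1::int)"] by simp
  also have "(\<Prod>a\<in>D. (if a \<in> Z then - 1 else 1) + 1) = (if D \<inter> Z = {} then 2 ^ card D else (0::int))"
  proof (cases "D \<inter> Z = {}")
    case True
    then have "(\<Prod>a\<in>D. (if a \<in> Z then - 1 else 1) + 1) = (\<Prod>a\<in>D. 2::int)"
      by (intro prod.cong) auto
    then show ?thesis using True by simp
  next
    case False
    then show ?thesis using fin by (auto intro!: prod_zero)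
  qed
  finally show ?thesis by simp
qed

text \<open>The sum factors over \<open>S\<close>: an element contributes 2 if it lies in
  \<open>T\<close> and 0 otherwise. Alternating signs on \<open>Pow S\<close> thus detect
  containment.\<close>

lemma sum_alternating_walsh:
  assumes "finite S"
  shows "(\<Sum>Z\<in>Pow S. (- 1) ^ card Z * walsh T Z) = (if S \<subseteq> T then 2 ^ card S else 0)"
proof -
  have "(\<Sum>Z\<in>Pow S. (- 1) ^ card Z * walsh T Z) = (\<Sum>Z\<in>Pow S. \<Prod>a\<in>Z. if a \<in> T then 1 else - 1)"
  proof (intro sum.cong refl)
    fix Z assume "Z \<in> Pow S"
    then have "finite Z" using assms finite_subset by auto
    then have "(- 1) ^ card Z * walsh T Z = (\<Prod>a\<in>Z. (- 1) * (if a \<in> T then - 1 else 1))"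
      by (simp add: walsh_commute[of T] walsh_conv_prod prod_uminus)
    also have "\<dots> = (\<Prod>a\<in>Z. if a \<in> T then 1 else - 1)"
      by (intro prod.cong) auto
    finally show "(- 1) ^ card Z * walsh T Z = (\<Prod>a\<in>Z. if a \<in> T then 1 else - 1)" .
  qed
  also have "\<dots> = (\<Prod>a\<in>S. (if a \<in> T then 1 else - 1) + 1)"
    by (rule sum_Pow_prod[OF assms])
  also have "\<dots> = (if S \<subseteq> T then 2 ^ card S else 0)"
  proof (cases "S \<subseteq> T")
    case True
    then have "(\<Prod>a\<in>S. (if a \<in> T then 1 else - 1) + 1) = (\<Prod>a\<in>S. 2::int)"
      by (intro prod.cong) auto
    then show ?thesis using True by simp
  next
    case False
    then show ?thesis using assms by (auto intro!: prod_zero)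
  qed
  finally show ?thesis .
qed

locale subset_order =
  fixes m :: nat and A :: "nat \<Rightarrow> nat set"
  assumes bij: "bij_betw A {..<2 ^ m} (Pow {..<m})"
    and card_mono: "\<And>i j. i \<le> j \<Longrightarrow> j < 2 ^ m \<Longrightarrow> card (A i) \<le> card (A j)"
    and adjacent: "\<And>i. Suc i < 2 ^ m \<Longrightarrow> card (A (Suc i) \<inter> A i) + 1 = card (A (Suc i))"
begin

lemma A_subset: "i < 2 ^ m \<Longrightarrow> A i \<subseteq> {..<m}"
  using bij by (auto simp: bij_betw_def)

lemma finite_A: "i < 2 ^ m \<Longrightarrow> finite (A i)"
  using A_subset finite_subset by blast

lemma A_inj: "i < 2 ^ m \<Longrightarrow> j < 2 ^ m \<Longrightarrow> A i = A j \<Longrightarrow> i = j"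
  using bij by (auto simp: bij_betw_def inj_on_def)

lemma A_surj: "S \<subseteq> {..<m} \<Longrightarrow> \<exists>i<2 ^ m. A i = S"
proof -
  assume "S \<subseteq> {..<m}"
  then have "S \<in> A ` {..<2 ^ m}" using bij by (simp add: bij_betw_def)
  then show ?thesis by auto
qed

lemma less_of_card_less: "i < 2 ^ m \<Longrightarrow> j < 2 ^ m \<Longrightarrow> card (A i) < card (A j) \<Longrightarrow> i < j"
  using card_mono[of j i] by (cases "i < j") auto

lemma less_of_psubset: "i < 2 ^ m \<Longrightarrow> j < 2 ^ m \<Longrightarrow> A i \<subset> A j \<Longrightarrow> i < j"
  by (simp add: less_of_card_less psubset_card_mono finite_A)

text \<open>Ordering by size extends inclusion; the triangularity of the matrix rests on
  this.\<close>

lemma le_of_subset: "i < 2 ^ m \<Longrightarrow> j < 2 ^ m \<Longrightarrow> A i \<subseteq> A j \<Longrightarrow> i \<le> j"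
  using less_of_psubset[of i j] A_inj[of i j] by (cases "A i = A j") (simp_all add: psubset_eq)

lemma A_0: "A 0 = {}"
proof -
  obtain i where "i < 2 ^ m" "A i = {}" using A_surj[of "{}"] by auto
  then show ?thesis using card_mono[of 0 i] finite_A[of 0] by simp
qed

text \<open>The signs are chosen so that adding \<open>walsh (A i) Z\<close> gives 0 whenever
  \<open>Z\<close> meets \<open>A (Suc i) \<inter> A i\<close>. What remains is an indicator times
  two characters, hence a combination of Walsh functions of subsets of \<open>A (Suc i)\<close> and
  \<open>A i\<close>.\<close>

fun row :: "nat \<Rightarrow> nat set \<Rightarrow> int" where
  "row 0 Z = 1"
| "row (Suc i) Z = (if A (Suc i) \<inter> A i \<inter> Z = {} then walsh (A (Suc i)) Z else - walsh (A i) Z)"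

lemma row_cases: "row i Z = 1 \<or> row i Z = - 1"
  using walsh_cases[of "A i" Z] walsh_cases[of "A (i - 1)" Z] by (cases i) auto

lemma row_expansion:
  assumes "Suc i < 2 ^ m"
  defines "D \<equiv> A (Suc i) \<inter> A i"
  shows "2 ^ card D * (row (Suc i) Z + walsh (A i) Z) =
    (\<Sum>T\<in>Pow D. walsh (A (Suc i) - T) Z + walsh (A i - T) Z)"
proof -
  have "finite (A (Suc i))" "finite (A i)" "D \<subseteq> A (Suc i)" "D \<subseteq> A i"
    using assms finite_A by auto
  then show ?thesis
    by (simp add: sum.distrib sum_walsh_Diff) (auto simp: D_def algebra_simps)
qed

text \<open>In the Walsh expansion of row \<open>j\<close> only sets containing \<open>A n\<close>
  survive. Every set involved has index at most \<open>j\<close>, so for \<open>j > 0\<close> this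
  leaves \<open>A j\<close> itself when \<open>n = j\<close>; the value 2 is
  \<open>2 ^ card (A n)\<close> divided by the factor \<open>2 ^ card D\<close>.\<close>

lemma sum_alternating_row:
  assumes n: "n < 2 ^ m" and j: "j \<le> n"
  shows "(\<Sum>Z\<in>Pow (A n). (- 1) ^ card Z * row j Z) = (if j < n then 0 else if n = 0 then 1 else 2)"
proof (cases j)
  case 0
  then show ?thesis
    using sum_alternating_walsh[OF finite_A[OF n], of "{}"] A_inj[of n 0] n A_0 by auto
next
  case (Suc i)
  define D where "D = A (Suc i) \<inter> A i"
  have i: "Suc i < 2 ^ m" using Suc n j by simp
  have fn: "finite (A n)" by (rule finite_A[OF n])
  have ni: "\<not> A n \<subseteq> A i" using le_of_subset[of n i] n i j Suc by auto
  have nj: "A n \<subseteq> A (Suc i) - T \<longleftrightarrow> n = j \<and> T = {}" if "T \<in> Pow D" for T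
    using le_of_subset[of n j] n i j Suc that by (auto simp: D_def)
  have "2 ^ card D * (\<Sum>Z\<in>Pow (A n). (- 1) ^ card Z * row j Z) + 2 ^ card D * (\<Sum>Z\<in>Pow (A n). (- 1) ^ card Z * walsh (A i) Z)
     = (\<Sum>Z\<in>Pow (A n). (- 1) ^ card Z * (2 ^ card D * (row (Suc i) Z + walsh (A i) Z)))"
    by (simp add: Suc sum_distrib_left sum.distrib algebra_simps)
  also have "\<dots> = (\<Sum>Z\<in>Pow (A n). (- 1) ^ card Z * (\<Sum>T\<in>Pow D. walsh (A (Suc i) - T) Z + walsh (A i - T) Z))"
    unfolding D_def row_expansion[OF i] ..
  also have "\<dots> = (\<Sum>T\<in>Pow D. (\<Sum>Z\<in>Pow (A n). (- 1) ^ card Z * walsh (A (Suc i) - T) Z)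
       + (\<Sum>Z\<in>Pow (A n). (- 1) ^ card Z * walsh (A i - T) Z))"
    unfolding sum_distrib_left sum.distrib[symmetric] distrib_left[symmetric] by (rule sum.swap)
  also have "\<dots> = (\<Sum>T\<in>Pow D. if n = j \<and> T = {} then 2 ^ card (A n) else 0)"
    using ni nj by (intro sum.cong refl) (auto simp: sum_alternating_walsh[OF fn])
  also have "\<dots> = (if n = j then 2 ^ card (A n) else 0)"
    using finite_A[OF i] by (auto simp: D_def)
  finally have "2 ^ card D * (\<Sum>Z\<in>Pow (A n). (- 1) ^ card Z * row j Z) = (if n = j then 2 ^ card (A n) else 0)"
    using ni by (simp add: sum_alternating_walsh[OF fn])
  moreover have "(2::int) ^ card (A n) = 2 ^ card D * 2" if "n = j"
    using adjacent[OF i] that Suc by (simp add: D_def flip: power_Suc2)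
  ultimately show ?thesis using j Suc by auto
qed

text \<open>By the previous lemma the functions \<open>Z \<mapsto> (-1)\<^bsup>|Z|\<^esup>\<close> on the subsets of \<open>A n\<close> make the matrix triangular with
  diagonal 1, 2, 2, \<dots>; the factor 2 is harmless because all entries are odd.\<close>

lemma integer_solution:
  fixes e :: "nat \<Rightarrow> int"
  assumes "\<And>i. odd (e i)" "n \<le> 2 ^ m"
  shows "\<exists>w. \<forall>j<n. (\<Sum>Z\<in>Pow {..<m}. w Z * row j Z) = e j"
  using assms(2)
proof (induction n)
  case (Suc n)
  then obtain w where w: "\<And>j. j < n \<Longrightarrow> (\<Sum>Z\<in>Pow {..<m}. w Z * row j Z) = e j" by auto
  have n: "n < 2 ^ m" using Suc by simp
  define g :: "nat set \<Rightarrow> int" where "g Z = (if Z \<subseteq> A n then (- 1) ^ card Z else 0)" for Z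
  have g: "(\<Sum>Z\<in>Pow {..<m}. g Z * row j Z) = (if j < n then 0 else if n = 0 then 1 else 2)" if "j \<le> n" for j
  proof -
    have "(\<Sum>Z\<in>Pow {..<m}. g Z * row j Z) = (\<Sum>Z\<in>Pow (A n). (- 1) ^ card Z * row j Z)"
      using A_subset[OF n] by (intro sum.mono_neutral_cong_right) (auto simp: g_def)
    then show ?thesis using sum_alternating_row[OF n that] by simp
  qed
  define r where "r = e n - (\<Sum>Z\<in>Pow {..<m}. w Z * row n Z)"
  have "\<exists>x. r = x * (if n = 0 then 1 else 2)"
  proof (cases "n = 0")
    case False
    have "(\<Sum>Z\<in>Pow {..<m}. w Z * row 0 Z) = e 0" using w[of 0] False by simp
    \<comment> \<open>All rows agree modulo 2 with row 0, whose value on \<open>w\<close> is already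
      the odd number \<open>e 0\<close>.\<close>
    moreover have "even ((\<Sum>Z\<in>Pow {..<m}. w Z * row n Z) - (\<Sum>Z\<in>Pow {..<m}. w Z * row 0 Z))"
      unfolding sum_subtractf[symmetric] right_diff_distrib[symmetric]
    proof (intro dvd_sum dvd_mult)
      show "even (row n Z - row 0 Z)" for Z using row_cases[of n Z] by auto
    qed
    ultimately have "even r" using assms(1)[of n] assms(1)[of 0] by (simp add: r_def)
    then show ?thesis using False by (auto elim!: evenE)
  qed auto
  then obtain x where x: "r = x * (if n = 0 then 1 else 2)" by blast
  have "(\<Sum>Z\<in>Pow {..<m}. (w Z + x * g Z) * row j Z) = e j" if "j < Suc n" for j
  proof -
    have "(\<Sum>Z\<in>Pow {..<m}. (w Z + x * g Z) * row j Z) =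
      (\<Sum>Z\<in>Pow {..<m}. w Z * row j Z) + x * (\<Sum>Z\<in>Pow {..<m}. g Z * row j Z)"
      by (simp add: algebra_simps sum.distrib sum_distrib_left)
    then show ?thesis
      using that g[of j] w[of j] x by (cases "j = n") (auto simp: r_def split: if_splits)
  qed
  then show ?case by (intro exI[of _ "\<lambda>Z. w Z + x * g Z"]) auto
qed auto

end

section \<open>Growth of the Walsh coefficients\<close>

context subset_order
begin

text \<open>The recursion is separated from the signed sequence behind it: \<open>y_empty\<close> is
  the equation of row 0, and \<open>y_eq\<close> is that of row \<open>Suc i\<close> after
  \<open>row_expansion\<close>.\<close>

context
  fixes y :: "nat set \<Rightarrow> int"
  assumes y_empty: "y {} = 1"
    and y_eq: "\<And>i. Suc i < 2 ^ m \<Longrightarrow>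
      2 ^ card (A (Suc i) \<inter> A i) * ((if card (A (Suc i)) \<le> 2 then 1 else - 1) + y (A i)) =
      (\<Sum>T\<in>Pow (A (Suc i) \<inter> A i). y (A (Suc i) - T) + y (A i - T))"
begin

definition rest :: "nat \<Rightarrow> int" where
  "rest i = (\<Sum>T\<in>Pow (A (Suc i) \<inter> A i) - {{}}. y (A (Suc i) - T) + y (A i - T))"

lemma y_step:
  assumes "Suc i < 2 ^ m"
  shows "y (A (Suc i)) = 2 ^ card (A (Suc i) \<inter> A i) *
      ((if card (A (Suc i)) \<le> 2 then 1 else - 1) + y (A i)) - y (A i) - rest i"
proof -
  have "finite (Pow (A (Suc i) \<inter> A i))" using finite_A[OF assms] by simp
  from sum.remove[OF this, of "{}" "\<lambda>T. y (A (Suc i) - T) + y (A i - T)"] show ?thesis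
    unfolding y_eq[OF assms] by (simp add: rest_def)
qed

text \<open>Proper subsets come earlier, and \<open>A (Suc i) - T\<close> cannot be
  \<open>A i\<close> because it lacks an element of \<open>T\<close>, which lies in
  \<open>A i\<close>.\<close>

lemma rest_index:
  assumes "Suc i < 2 ^ m" "T \<in> Pow (A (Suc i) \<inter> A i) - {{}}"
  obtains p q where "p < i" "A p = A (Suc i) - T" "q < i" "A q = A i - T"
proof -
  have "A (Suc i) - T \<subseteq> {..<m}" "A i - T \<subseteq> {..<m}"
    using A_subset[of "Suc i"] A_subset[of i] assms by auto
  then obtain p q where p: "p < 2 ^ m" "A p = A (Suc i) - T" and q: "q < 2 ^ m" "A q = A i - T"
    using A_surj by meson
  obtain x where x: "x \<in> T" "x \<in> A (Suc i)" "x \<in> A i" using assms(2) by blast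
  then have "A p \<subset> A (Suc i)" "A q \<subset> A i" "A p \<noteq> A i" using p(2) q(2) by blast+
  then have "p < Suc i" "q < i" "p \<noteq> i" using less_of_psubset p(1) q(1) assms(1) by auto
  then show ?thesis using that[OF _ p(2) _ q(2)] by simp
qed

text \<open>The constant 1 solves the recursion while the right-hand side is 1: with
  \<open>P = 2 ^ card (A (Suc i) \<inter> A i)\<close> it reads
  \<open>2 * P - 1 - 2 * (P - 1) = 1\<close>.\<close>

lemma y_small: "i < 2 ^ m \<Longrightarrow> card (A i) \<le> 2 \<Longrightarrow> y (A i) = 1"
proof (induction i rule: less_induct)
  case (less i)
  show ?case
  proof (cases i)
    case 0
    then show ?thesis by (simp add: A_0 y_empty)
  next
    case (Suc j)
    have j: "Suc j < 2 ^ m" using Suc less by simp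
    have IH: "y (A p) = 1" if "p \<le> j" for p
      using less card_mono[of p i] that Suc by auto
    have "rest j = (\<Sum>T\<in>Pow (A (Suc j) \<inter> A j) - {{}}. 2)"
      unfolding rest_def
    proof (intro sum.cong refl)
      fix T assume "T \<in> Pow (A (Suc j) \<inter> A j) - {{}}"
      from rest_index[OF j this] obtain p q
        where "p < j" "A p = A (Suc j) - T" "q < j" "A q = A j - T" .
      then show "y (A (Suc j) - T) + y (A j - T) = 2" using IH[of p] IH[of q] by simp
    qed
    also have "\<dots> = 2 * (2 ^ card (A (Suc j) \<inter> A j) - 1)"
      using finite_A[OF j]
      by (simp add: card_Diff_subset card_Pow of_nat_diff algebra_simps del: Pow_Int_eq)
    finally show ?thesis
      using y_step[OF j] IH[of j] less(3) Suc by simp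
  qed
qed

text \<open>With right-hand side 1 on the sets of size at most 2 and -1 on the others, the coefficients are 1 on the former
  and negative on the latter. Debt measures the negative part, and the induction keeps it dominated by
  its last term.\<close>

definition debt :: "nat set \<Rightarrow> int" where
  "debt S = (if card S \<le> 2 then 0 else - y S)"

text \<open>The sets occurring in \<open>rest i\<close> are pairwise distinct and precede
  \<open>A i\<close>, so each earlier debt is charged at most once.\<close>

lemma rest_lower_bound:
  assumes i: "Suc i < 2 ^ m" and debt: "\<And>j. j < i \<Longrightarrow> 0 \<le> debt (A j)"
  shows "- (\<Sum>j<i. debt (A j)) \<le> rest i"
proof -
  define D where "D = A (Suc i) \<inter> A i"
  define P where "P = Pow D - {{}}"
  have fin: "finite P" using finite_A[OF i] by (simp add: P_def D_def)
  have "card D < card (A (Suc i))" using adjacent[OF i] by (simp add: D_def)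
  \<comment> \<open>This element survives in every \<open>A (Suc i) - T\<close> and is in no
    \<open>A i - T\<close>, which separates the two families.\<close>
  then obtain b where b: "b \<in> A (Suc i)" "b \<notin> A i"
    unfolding D_def by (metis IntI inf_le1 less_irrefl subsetI subset_antisym)
  have inj1: "inj_on (\<lambda>T. A (Suc i) - T) P" and inj2: "inj_on (\<lambda>T. A i - T) P"
    by (auto simp: inj_on_def P_def D_def)
  have disj: "(\<lambda>T. A (Suc i) - T) ` P \<inter> (\<lambda>T. A i - T) ` P = {}"
    using b by (auto simp: P_def D_def)
  have range: "(\<lambda>T. A (Suc i) - T) ` P \<union> (\<lambda>T. A i - T) ` P \<subseteq> A ` {..<i}"
  proof (intro Un_least image_subsetI)
    fix T assume "T \<in> P"
    then obtain p q where "p < i" "A p = A (Suc i) - T" "q < i" "A q = A i - T"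
      using rest_index[OF i, of T] unfolding P_def D_def by metis
    then show "A (Suc i) - T \<in> A ` {..<i}" "A i - T \<in> A ` {..<i}"
      by (auto intro: image_eqI[OF sym])
  qed
  have y_ge: "- debt (A j) \<le> y (A j)" if "j < i" for j
    using y_small[of j] that i by (auto simp: debt_def)
  have inj_A: "inj_on A {..<i}" using A_inj i by (auto simp: inj_on_def)
  let ?O = "(\<lambda>T. A (Suc i) - T) ` P \<union> (\<lambda>T. A i - T) ` P"
  have "- (\<Sum>j<i. debt (A j)) = (\<Sum>S\<in>A ` {..<i}. - debt S)"
    by (simp add: sum.reindex[OF inj_A] sum_negf)
  also have "\<dots> \<le> (\<Sum>S\<in>?O. - debt S)"
    unfolding sum_negf neg_le_iff_le using range debt by (intro sum_mono2) auto
  also have "\<dots> \<le> (\<Sum>S\<in>?O. y S)"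
  proof (rule sum_mono)
    fix S assume "S \<in> ?O"
    then have "S \<in> A ` {..<i}" using range by blast
    then obtain j where "j < i" "S = A j" by auto
    then show "- debt S \<le> y S" using y_ge by simp
  qed
  also have "\<dots> = (\<Sum>T\<in>P. y (A (Suc i) - T)) + (\<Sum>T\<in>P. y (A i - T))"
    using fin disj by (simp add: sum.union_disjoint sum.reindex[OF inj1] sum.reindex[OF inj2])
  also have "\<dots> = rest i"
    by (simp add: rest_def P_def D_def sum.distrib)
  finally show ?thesis .
qed

text \<open>Bounding the total earlier debt by the current coefficient controls \<open>rest\<close>
  in the next step. The constant 8 is \<open>2 ^ 3\<close>, from the first set of size 3: the
  previous coefficient is 1 there and the new one is only known to be at most -1.\<close>

lemma y_growth_invariant:
  "i < 2 ^ m \<Longrightarrow> (\<forall>j\<le>i. 0 \<le> debt (A j)) \<and>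
     (card (A i) > 2 \<longrightarrow> y (A i) \<le> - 1 \<and> (\<Sum>j<i. debt (A j)) \<le> - y (A i)) \<and>
     (\<forall>j. i = Suc j \<longrightarrow> 2 ^ card (A i) * \<bar>y (A j)\<bar> \<le> 8 * \<bar>y (A i)\<bar>)"
proof (induction i)
  case 0
  then show ?case by (simp add: A_0 debt_def)
next
  case (Suc i)
  then have i: "Suc i < 2 ^ m" and ge0: "\<And>j. j \<le> i \<Longrightarrow> 0 \<le> debt (A j)"
    and big: "card (A i) > 2 \<Longrightarrow> y (A i) \<le> - 1" "card (A i) > 2 \<Longrightarrow> (\<Sum>j<i. debt (A j)) \<le> - y (A i)"
    by auto
  have sum_Suc: "(\<Sum>j<Suc i. debt (A j)) = (\<Sum>j<i. debt (A j)) + debt (A i)" by simp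
  show ?case
  proof (cases "card (A (Suc i)) \<le> 2")
    case True
    then have "card (A i) \<le> 2" using card_mono[of i "Suc i"] i by simp
    then have "y (A i) = 1" "y (A (Suc i)) = 1" using y_small True i by auto
    moreover have "(2::int) ^ card (A (Suc i)) \<le> 2 ^ 3" using True by (intro power_increasing) auto
    ultimately show ?thesis using True ge0 by (auto simp: debt_def le_Suc_eq)
  next
    case False
    define P :: int where "P = 2 ^ card (A (Suc i) \<inter> A i)"
    have pow: "2 ^ card (A (Suc i)) = 2 * P"
      using adjacent[OF i] by (simp add: P_def flip: power_Suc)
    have "(2::int) ^ 2 \<le> P"
      unfolding P_def using adjacent[OF i] False by (intro power_increasing) auto
    then have P4: "4 \<le> P" by simp
    have step: "y (A (Suc i)) = P * (y (A i) - 1) - y (A i) - rest i"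
      using y_step[OF i] False by (simp add: P_def)
    have rest: "- (\<Sum>j<i. debt (A j)) \<le> rest i"
      using rest_lower_bound[OF i] ge0 by simp
    have "y (A (Suc i)) \<le> - 1 \<and> (\<Sum>j<Suc i. debt (A j)) \<le> - y (A (Suc i)) \<and>
      2 ^ card (A (Suc i)) * \<bar>y (A i)\<bar> \<le> 8 * \<bar>y (A (Suc i))\<bar>"
    proof (cases "card (A i) \<le> 2")
      case True
      have y1: "y (A i) = 1" using y_small True i by simp
      have "debt (A j) = 0" if "j \<le> i" for j
        using card_mono[of j i] that True i by (simp add: debt_def)
      then have zero: "(\<Sum>j<i. debt (A j)) = 0" "debt (A i) = 0" by simp_all
      have "card (A (Suc i) \<inter> A i) \<le> card (A i)"
        using finite_A[of i] i by (intro Finite_Set.card_mono) auto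
      then have "card (A (Suc i)) \<le> 3" using True adjacent[OF i] by simp
      then have "(2::int) ^ card (A (Suc i)) \<le> 2 ^ 3" by (intro power_increasing) auto
      moreover have "y (A (Suc i)) \<le> - 1" using step y1 rest zero by simp
      ultimately show ?thesis using y1 zero by simp
    next
      case False
      define u where "u = - y (A i)"
      have u: "1 \<le> u" "(\<Sum>j<i. debt (A j)) \<le> u" using big False by (auto simp: u_def)
      have Pu: "4 * u \<le> P * u" using P4 u by (intro mult_right_mono) auto
      \<comment> \<open>One \<open>u\<close> comes from the term \<open>- y (A i)\<close>, the other
        from the bound on earlier debt. As \<open>P\<close> is at least 4, the remainder still pays
        for the old debt together with the new \<open>u\<close>.\<close>
      have "P * u + P - 2 * u \<le> - y (A (Suc i))"
        using step rest u by (simp add: u_def algebra_simps)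
      then have "2 * u + 4 \<le> - y (A (Suc i))" "P * u \<le> 4 * - y (A (Suc i))"
        using P4 Pu u by linarith+
      moreover have "debt (A i) = u" using False by (simp add: debt_def u_def)
      moreover have "\<bar>y (A i)\<bar> = u" using u by (simp add: u_def)
      ultimately show ?thesis
        using u unfolding pow sum_Suc by simp
    qed
    then show ?thesis using ge0 False by (auto simp: debt_def le_Suc_eq)
  qed
qed

lemma y_growth: "i < 2 ^ m \<Longrightarrow> 2 ^ (\<Sum>j\<le>i. card (A j)) \<le> 8 ^ i * \<bar>y (A i)\<bar>"
proof (induction i)
  case 0
  then show ?case by (simp add: A_0 y_empty)
next
  case (Suc i)
  have "2 ^ (\<Sum>j\<le>Suc i. card (A j)) = 2 ^ card (A (Suc i)) * (2 ^ (\<Sum>j\<le>i. card (A j)) :: int)"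
    by (simp add: power_add)
  also have "\<dots> \<le> 2 ^ card (A (Suc i)) * (8 ^ i * \<bar>y (A i)\<bar>)"
    using Suc by (intro mult_left_mono) auto
  also have "\<dots> = 8 ^ i * (2 ^ card (A (Suc i)) * \<bar>y (A i)\<bar>)" by simp
  also have "\<dots> \<le> 8 ^ i * (8 * \<bar>y (A (Suc i))\<bar>)"
    using y_growth_invariant[OF Suc(2)] by (intro mult_left_mono) auto
  finally show ?case by simp
qed

end

section \<open>Length of signed solutions\<close>

lemma sum_card_A: "2 * (\<Sum>j<2 ^ m. card (A j)) = m * 2 ^ m"
proof -
  have "(\<Sum>j<2 ^ m. card (A j)) = (\<Sum>S\<in>Pow {..<m}. card S)"
    by (rule sum.reindex_bij_betw[OF bij])
  moreover have "(\<Sum>S\<in>Pow {..<m}. card S) = (\<Sum>S\<in>Pow {..<m}. card ({..<m} - S))"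
    by (rule sum.reindex_bij_witness[of _ "\<lambda>S. {..<m} - S" "\<lambda>S. {..<m} - S"])
      (auto simp: double_diff)
  moreover have "(\<Sum>S\<in>Pow {..<m}. card S) + (\<Sum>S\<in>Pow {..<m}. card ({..<m} - S)) = (\<Sum>S\<in>Pow {..<m}. m)"
    unfolding sum.distrib[symmetric]
  proof (intro sum.cong refl)
    fix S assume "S \<in> Pow {..<m}"
    then show "card S + card ({..<m} - S) = m"
      using Finite_Set.card_mono[of "{..<m}" S] finite_subset[of S "{..<m}"] by (simp add: card_Diff_subset)
  qed
  ultimately show ?thesis by (simp add: card_Pow mult_2)
qed

text \<open>A sum of \<open>t\<close> signs bounds every Walsh coefficient by \<open>t\<close>; the
  last coefficient has collected all growth factors.\<close>

lemma solution_length: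
  fixes s :: "nat \<Rightarrow> int"
  assumes s: "\<And>k. k < t \<Longrightarrow> s k = 1 \<or> s k = - 1"
    and sol: "\<And>i. i < 2 ^ m \<Longrightarrow> (\<Sum>k<t. s k * row i (z k)) = (if card (A i) \<le> 2 then 1 else - 1)"
  shows "(1 / 64 * 2 ^ m) powr (2 ^ m / 2) \<le> real t"
proof -
  define y where "y S = (\<Sum>k<t. s k * walsh S (z k))" for S
  define l :: nat where "l = 2 ^ m - 1"
  have l: "l < 2 ^ m" "{..l} = {..<2 ^ m}" by (simp_all add: l_def lessThan_Suc_atMost[symmetric])
  have "y {} = 1" using sol[of 0] by (simp add: y_def A_0)
  moreover have "2 ^ card (A (Suc i) \<inter> A i) * ((if card (A (Suc i)) \<le> 2 then 1 else - 1) + y (A i)) =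
      (\<Sum>T\<in>Pow (A (Suc i) \<inter> A i). y (A (Suc i) - T) + y (A i - T))" if i: "Suc i < 2 ^ m" for i
  proof -
    have "2 ^ card (A (Suc i) \<inter> A i) * ((if card (A (Suc i)) \<le> 2 then 1 else - 1) + y (A i)) =
      (\<Sum>k<t. s k * (2 ^ card (A (Suc i) \<inter> A i) * (row (Suc i) (z k) + walsh (A i) (z k))))"
      unfolding sol[OF i, symmetric] y_def sum.distrib[symmetric] sum_distrib_left
      by (intro sum.cong refl) (simp only: algebra_simps)
    also have "\<dots> = (\<Sum>k<t. s k * (\<Sum>T\<in>Pow (A (Suc i) \<inter> A i). walsh (A (Suc i) - T) (z k) + walsh (A i - T) (z k)))"
      unfolding row_expansion[OF i] ..
    also have "\<dots> = (\<Sum>T\<in>Pow (A (Suc i) \<inter> A i). y (A (Suc i) - T) + y (A i - T))"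
      by (simp add: y_def sum_distrib_left distrib_left sum.swap[of _ "{..<t}"] flip: sum.distrib)
    finally show ?thesis .
  qed
  ultimately have "2 ^ (\<Sum>j\<le>l. card (A j)) \<le> 8 ^ l * \<bar>y (A l)\<bar>"
    using l(1) by (rule y_growth)
  moreover have "\<bar>y (A l)\<bar> \<le> int t"
  proof -
    have "\<bar>y (A l)\<bar> \<le> (\<Sum>k<t. \<bar>s k * walsh (A l) (z k)\<bar>)"
      unfolding y_def by (rule sum_abs)
    also have "\<dots> = (\<Sum>k<t. 1)"
    proof (intro sum.cong refl)
      fix k assume "k \<in> {..<t}"
      then show "\<bar>s k * walsh (A l) (z k)\<bar> = 1"
        using s[of k] walsh_cases[of "A l" "z k"] by auto
    qed
    finally show ?thesis by simp
  qed
  moreover have "(8::int) ^ l \<le> 8 ^ 2 ^ m" using l(1) by (intro power_increasing) auto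
  ultimately have "2 ^ (\<Sum>j\<le>l. card (A j)) \<le> 8 ^ 2 ^ m * int t"
    by (elim order_trans) (intro mult_mono; simp)
  then have "real_of_int (2 ^ (\<Sum>j<2 ^ m. card (A j))) \<le> real_of_int (8 ^ 2 ^ m * int t)"
    unfolding l(2) by (simp only: of_int_le_iff)
  then have main: "2 ^ (\<Sum>j<2 ^ m. card (A j)) \<le> 8 ^ 2 ^ m * real t" by simp
  have "real (\<Sum>j<2 ^ m. card (A j)) = real m * (2 ^ m / 2)"
    using arg_cong[OF sum_card_A, of real] by simp
  then have "(2::real) ^ (\<Sum>j<2 ^ m. card (A j)) = 2 powr (real m * (2 ^ m / 2))"
    using powr_realpow[of "2::real" "\<Sum>j<2 ^ m. card (A j)"] by (simp only: zero_less_numeral)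
  also have "\<dots> = (2 ^ m) powr (2 ^ m / 2)"
    by (simp add: powr_powr flip: powr_realpow)
  finally have two: "(2::real) ^ (\<Sum>j<2 ^ m. card (A j)) = (2 ^ m) powr (2 ^ m / 2)" .
  \<comment> \<open>The loss of a factor 8 per step, over \<open>d = 2 ^ m\<close> steps, is
    \<open>64 powr (d / 2)\<close>; hence the constant 1/64.\<close>
  have "(64::real) powr (2 ^ m / 2) = (8 powr 2) powr (2 ^ m / 2)"
    by simp
  also have "\<dots> = 8 powr (real (2 ^ m))"
    unfolding powr_powr by simp
  also have "\<dots> = 8 ^ 2 ^ m"
    by (rule powr_realpow) simp
  finally have sixtyfour: "(64::real) powr (2 ^ m / 2) = 8 ^ 2 ^ m" .
  have "(1 / 64 * 2 ^ m) powr (2 ^ m / 2) = (2 ^ m) powr (2 ^ m / 2) / (64 powr (2 ^ m / 2) :: real)"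
    by (simp add: powr_divide)
  also have "\<dots> \<le> real t"
    using main unfolding two sixtyfour by (simp add: field_simps)
  finally show ?thesis .
qed

end

section \<open>Construction of the minimal sequence\<close>

lemma signed_sequence_of_weights:
  fixes w :: "'a \<Rightarrow> int"
  assumes "finite X"
  obtains t and s :: "nat \<Rightarrow> int" and z where "\<And>k. k < t \<Longrightarrow> s k = 1 \<or> s k = - 1"
    "\<And>f. (\<Sum>k<t. s k * f (z k)) = (\<Sum>x\<in>X. w x * f x)"
proof -
  \<comment> \<open>\<open>K\<close> holds \<open>\<bar>w x\<bar>\<close> copies of each
    \<open>x\<close>, each to be used with the sign of \<open>w x\<close>.\<close>
  define K where "K = (SIGMA x:X. {..<nat \<bar>w x\<bar>})"
  have fin: "finite K" using assms by (simp add: K_def)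
  obtain h where h: "bij_betw h {..<card K} K"
    using ex_bij_betw_nat_finite[OF fin] by (auto simp: atLeast0LessThan)
  show ?thesis
  proof
    fix k assume "k < card K"
    then have "h k \<in> K" using h by (auto simp: bij_betw_def)
    then show "sgn (w (fst (h k))) = 1 \<or> sgn (w (fst (h k))) = - 1"
      by (auto simp: K_def sgn_if)
  next
    fix f :: "'a \<Rightarrow> int"
    have "(\<Sum>k<card K. sgn (w (fst (h k))) * f (fst (h k))) = (\<Sum>p\<in>K. sgn (w (fst p)) * f (fst p))"
      by (rule sum.reindex_bij_betw[OF h])
    also have "\<dots> = (\<Sum>x\<in>X. \<Sum>j<nat \<bar>w x\<bar>. sgn (w x) * f x)"
      unfolding K_def using assms by (subst sum.Sigma) (auto simp: case_prod_beta)
    also have "\<dots> = (\<Sum>x\<in>X. w x * f x)"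
      by (intro sum.cong refl) (auto simp: abs_mult_sgn mult.assoc[symmetric])
    finally show "(\<Sum>k<card K. sgn (w (fst (h k))) * f (fst (h k))) = (\<Sum>x\<in>X. w x * f x)" .
  qed
qed

lemma (in subset_order) minimal_seq_exists:
  assumes "m > 6"
  shows "\<exists>t v. minimal_seq (2 ^ m) t v \<and> (1 / 64 * 2 ^ m) powr (2 ^ m / 2) \<le> real t"
proof -
  define e :: "nat \<Rightarrow> int" where "e i = (if card (A i) \<le> 2 then 1 else - 1)" for i
  define sol :: "nat \<Rightarrow> (nat \<Rightarrow> int) \<Rightarrow> (nat \<Rightarrow> nat set) \<Rightarrow> bool" where
    "sol t s z \<longleftrightarrow> (\<forall>k<t. s k = 1 \<or> s k = - 1) \<and> (\<forall>i<2 ^ m. (\<Sum>k<t. s k * row i (z k)) = e i)" for t s z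
  have odd_e: "odd (e i)" for i by (simp add: e_def)
  have e2: "e i * e i = 1" for i by (simp add: e_def)
  obtain w where w: "\<And>j. j < 2 ^ m \<Longrightarrow> (\<Sum>Z\<in>Pow {..<m}. w Z * row j Z) = e j"
    using integer_solution[of e "2 ^ m"] odd_e by blast
  have "\<exists>t s z. sol t s z"
  proof -
    obtain t and s :: "nat \<Rightarrow> int" and z where "\<And>k. k < t \<Longrightarrow> s k = 1 \<or> s k = - 1"
      "\<And>f. (\<Sum>k<t. s k * f (z k)) = (\<Sum>Z\<in>Pow {..<m}. w Z * f Z)"
      using signed_sequence_of_weights[of "Pow {..<m}" w] by auto
    then have "sol t s z" using w by (simp add: sol_def)
    then show ?thesis by blast
  qed
  then obtain t where t: "\<exists>s z. sol t s z" and least: "\<And>t'. \<exists>s z. sol t' s z \<Longrightarrow> t \<le> t'"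
    using exists_least_iff[of "\<lambda>t. \<exists>s z. sol t s z"] by (meson not_less)
  then obtain s z where sz: "sol t s z" by blast
  have len: "(1 / 64 * 2 ^ m) powr (2 ^ m / 2) \<le> real t"
    using sz by (intro solution_length[of t s z]) (auto simp: sol_def e_def)
  have t2: "2 \<le> t"
  proof -
    \<comment> \<open>From dimension 128 on the base is at least 2 and the exponent at least 1, so
      the length bound itself forces two vectors.\<close>
    have "(2::real) ^ 7 \<le> 2 ^ m" using assms by (intro power_increasing) auto
    then have big: "128 \<le> (2::real) ^ m" by simp
    have "(2::real) powr 1 \<le> 2 powr (2 ^ m / 2)" using big by (intro powr_mono) auto
    also have "\<dots> \<le> (1 / 64 * 2 ^ m) powr (2 ^ m / 2)" using big by (intro powr_mono2) auto
    finally show ?thesis using len by simp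
  qed
  \<comment> \<open>The factor \<open>- e i\<close> flips rows so that every coordinate of the total
    becomes \<open>- (e i * e i) = - 1\<close>.\<close>
  define u where "u k i = - (e i * (s k * row i (z k)))" for k i
  have sum_u: "(\<Sum>k\<in>S. u k i) = - (e i * (\<Sum>k\<in>S. s k * row i (z k)))" for S i
    by (simp add: u_def sum_negf sum_distrib_left)
  have "minimal_seq (2 ^ m) t (\<lambda>k i. if u k i = 1 then 1 else - 1 + 1 / (real t + 1))"
  proof (rule minimal_seq_of_sign_vectors[OF t2])
    fix k i assume "k < t"
    then show "u k i = 1 \<or> u k i = - 1"
      using sz row_cases[of i "z k"] by (auto simp: sol_def u_def e_def)
  next
    fix i :: nat assume "i < 2 ^ m"
    then show "(\<Sum>k<t. u k i) = - 1" using sz e2 by (simp add: sum_u sol_def)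
  next
    fix S assume S: "S \<subseteq> {..<t}" and eq: "\<And>i. i < 2 ^ m \<Longrightarrow> (\<Sum>k\<in>S. u k i) = - 1"
    have fin: "finite S" using S finite_subset by blast
    obtain h where h: "bij_betw h {..<card S} S"
      using ex_bij_betw_nat_finite[OF fin] by (auto simp: atLeast0LessThan)
    \<comment> \<open>Undoing the row flips, a subsequence with the same sum is a solution of length
      \<open>card S\<close>, against which \<open>t\<close> is least.\<close>
    have "sol (card S) (s \<circ> h) (z \<circ> h)"
      unfolding sol_def
    proof (intro conjI allI impI)
      fix k assume "k < card S"
      then have "h k < t" using h S by (auto simp: bij_betw_def)
      then show "(s \<circ> h) k = 1 \<or> (s \<circ> h) k = - 1" using sz by (auto simp: sol_def)
    next
      fix i :: nat assume i: "i < 2 ^ m"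
      have "(\<Sum>k<card S. (s \<circ> h) k * row i ((z \<circ> h) k)) = (\<Sum>k\<in>S. s k * row i (z k))"
        using sum.reindex_bij_betw[OF h, of "\<lambda>k. s k * row i (z k)"] by simp
      also have "\<dots> = e i"
        using eq[OF i] by (auto simp: sum_u e_def split: if_splits)
      finally show "(\<Sum>k<card S. (s \<circ> h) k * row i ((z \<circ> h) k)) = e i" .
    qed
    then have "t \<le> card S" using least by blast
    then show "S = {..<t}" using S by (intro card_seteq) auto
  qed auto
  then show ?thesis using len by blast
qed

text \<open>Opposite vectors; at length 2 no index set has an admissible size, so the second
  condition is vacuous.\<close>

lemma minimal_seq_two: "minimal_seq d 2 (\<lambda>k i. if k = 0 then 1 else - 1)"
  unfolding minimal_seq_def in_cube_def by (auto simp: lessThan_Suc numeral_2_eq_2)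

theorem theorem2:
  shows "\<exists>c>0. \<forall>d::nat. (\<exists>k::nat. d = 2 ^ k) \<longrightarrow>
           (\<exists>t v. minimal_seq d t v \<and> (c * real d) powr (real d / 2) \<le> real t)"
proof (intro exI[of _ "1 / 64 :: real"] conjI allI impI)
  fix d :: nat assume "\<exists>k::nat. d = 2 ^ k"
  then obtain m where d: "d = 2 ^ m" by blast
  show "\<exists>t v. minimal_seq d t v \<and> (1 / 64 * real d) powr (real d / 2) \<le> real t"
  proof (cases "m > 6")
    case True
    obtain A where "subset_order m A"
      using subset_enumeration[of m] unfolding subset_order_def by metis
    then show ?thesis
      using subset_order.minimal_seq_exists[OF _ True] d by simp
  next
    case False
    \<comment> \<open>Up to dimension 64 the base is at most 1, so length 2 suffices.\<close>
    then have "(2::real) ^ m \<le> 2 ^ 6" by (intro power_increasing) auto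
    then have "(1 / 64 * real d) powr (real d / 2) \<le> 1 powr (real d / 2)"
      using d by (intro powr_mono2) auto
    then have "(1 / 64 * real d) powr (real d / 2) \<le> real 2" by simp
    then show ?thesis using minimal_seq_two by blast
  qed
qed simp

end
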